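(* Let $M,N,L\ge1$ be integers and let $\mathcal{K}\subseteq\{1,\ldots,M\}$ be non-empty. Suppose that $\mathbb{A}$ is a $2M$-way hypercubic array with length $N$ in each direction that is of the form $$\mathbb{A}(i_1,\ldots,i_M;j_1,\ldots,j_M)=\sum_{\ell=1}^L A^{(1)}(i_1,\ell)\cdots A^{(M)}(i_M,\ell)\,\bar A^{(1)}(j_1,\ell)\cdots\bar A^{(M)}(j_M,\ell),$$ where each $A^{(m)}$ is an $N\times L$ complex matrix and $\bar A^{(m)}$ is its entrywise complex conjugate. Then $\mathrm{Det}_{\mathcal{K}}(\mathbb{A})=0$ if $L<N$, and otherwise $$\mathrm{Det}_{\mathcal{K}}(\mathbb{A})=\sum_{\mathcal{L}}\left[\prod_{k\in\mathcal{K}}\det(A^{(k)}_{\mathcal{L}})\det(\bar A^{(k)}_{\mathcal{L}})\right]\left[\prod_{k\notin\mathcal{K}}\mathrm{per}(A^{(k)}_{\mathcal{L}})\,\mathrm{per}(\bar A^{(k)}_{\mathcal{L}})\right]=\sum_{\mathcal{L}}\left[\prod_{k\in\mathcal{K}}|\det(A^{(k)}_{\mathcal{L}})|^2\right]\left[\prod_{k\notin\mathcal{K}}|\mathrm{per}(A^{(k)}_{\mathcal{L}})|^2\right],$$ where the sum is over all subsets $\mathcal{L}$ of $\{1,\ldots,L\}$ with cardinality $N$, and $A^{(k)}_{\mathcal{L}}$ is the $N\times N$ sub-matrix of $A^{(k)}$ formed by the columns of $A^{(k)}$ with indices in $\mathcal{L}$.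
   Context: $\mathfrak{S}_N$ is the symmetric group on $\{1,\ldots,N\}$, $\epsilon$ is the sign character, and $\mathrm{per}$ denotes the permanent. For a $2M$-way hypercubic array $\mathbb{A}(i_1,\ldots,i_M;j_1,\ldots,j_M)\in\mathbb{C}$, with all indices in $\{1,\ldots,N\}$, and $\mathcal{K}\subseteq\{1,\ldots,M\}$, the hyperdeterminant is $$\mathrm{Det}_{\mathcal{K}}(\mathbb{A}) := \frac{1}{N!}\sum_{\sigma_1,\ldots,\sigma_M\in\mathfrak{S}_N}\ \sum_{\tau_1,\ldots,\tau_M\in\mathfrak{S}_N}\ \prod_{k\in\mathcal{K}}\epsilon(\sigma_k)\epsilon(\tau_k)\ \prod_{n=1}^N \mathbb{A}(\sigma_1(n),\ldots,\sigma_M(n);\tau_1(n),\ldots,\tau_M(n)).$$ In products, $k\notin\mathcal{K}$ means $k\in\{1,\ldots,M\}\setminus\mathcal{K}$. The columns of $A^{(k)}_{\mathcal{L}}$ are taken in increasing order of index. *)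

theory Defs
  imports
    Complex_Main
    "HOL-Library.FuncSet"
    "HOL-Combinatorics.Permutations"
    "Jordan_Normal_Form.Determinant"
    "Jordan_Normal_Form.DL_Submatrix"
begin

text \<open>
  Conventions: the directions of a \<open>2M\<close>-way array are numbered by \<open>{1..M}\<close> (twice), while the
  positions along a direction, and the rows and columns of a matrix, are counted from \<open>0\<close> as in
  Jordan_Normal_Form.
\<close>

text \<open>
  A \<open>2M\<close>-way hypercubic array of length \<open>N\<close> is a function of two multi-indices
  \<open>i = (i\<^sub>1, \<dots>, i\<^sub>M)\<close> and \<open>j = (j\<^sub>1, \<dots>, j\<^sub>M)\<close>, of which only the values at members of
  \<open>multi_indices M N\<close> matter.
\<close>

type_synonym 'a hypercubic_array = "(nat \<Rightarrow> nat) \<Rightarrow> (nat \<Rightarrow> nat) \<Rightarrow> 'a"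

definition multi_indices :: "nat \<Rightarrow> nat \<Rightarrow> (nat \<Rightarrow> nat) set" where
  "multi_indices M N = {1..M} \<rightarrow>\<^sub>E {0..<N}"

definition perm_tuples :: "nat \<Rightarrow> nat \<Rightarrow> (nat \<Rightarrow> nat \<Rightarrow> nat) set" where
  "perm_tuples M N = {1..M} \<rightarrow>\<^sub>E {p. p permutes {0..<N}}"

text \<open>
  The restricted lambda abstractions below are the multi-indices
  \<open>(\<sigma>\<^sub>1(n), \<dots>, \<sigma>\<^sub>M(n))\<close> and \<open>(\<tau>\<^sub>1(n), \<dots>, \<tau>\<^sub>M(n))\<close>.
\<close>

definition hyperdet :: "nat \<Rightarrow> nat \<Rightarrow> nat set \<Rightarrow> complex hypercubic_array \<Rightarrow> complex" where
  "hyperdet M N K T =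
     1 / fact N *
     (\<Sum>\<sigma>\<in>perm_tuples M N. \<Sum>\<tau>\<in>perm_tuples M N.
        (\<Prod>k\<in>K. of_int (sign (\<sigma> k)) * of_int (sign (\<tau> k))) *
        (\<Prod>n\<in>{0..<N}. T (\<lambda>m\<in>{1..M}. \<sigma> m n) (\<lambda>m\<in>{1..M}. \<tau> m n)))"

text \<open>As for \<open>det\<close>, the value at a non-square matrix is \<open>0\<close> by convention.\<close>

definition permanent :: "'a :: comm_ring_1 mat \<Rightarrow> 'a" where
  "permanent A =
     (if dim_row A = dim_col A
      then \<Sum>p | p permutes {0..<dim_row A}. \<Prod>i\<in>{0..<dim_row A}. A $$ (i, p i)
      else 0)"

text \<open>
  \<open>submatrix\<close> enumerates the selected columns in increasing order.
\<close>

definition column_submatrix :: "'a mat \<Rightarrow> nat set \<Rightarrow> 'a mat" where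
  "column_submatrix A S = submatrix A UNIV S"

end

theory Submission
  imports Defs
begin

text \<open>
  This is a Cauchy-Binet formula in \<open>2M\<close> directions. Expanding the product over \<open>n\<close> of the
  rank-one sums introduces a function \<open>f\<close> that picks a column \<open>f n\<close> for each position \<open>n\<close>. For
  fixed \<open>f\<close> the summand splits into one factor per permutation, so the \<open>2M\<close> sums over
  permutations separate: direction \<open>m\<close> contributes the determinant (if \<open>m \<in> K\<close>) or the
  permanent (if \<open>m \<notin> K\<close>) of the matrix whose \<open>n\<close>-th column is column \<open>f n\<close>. This is
  \<open>hyperdet_eq_sum_column_immanants\<close>.

  As \<open>K\<close> is non-empty, at least one factor is a determinant, and it vanishes as soon as \<open>f\<close>
  repeats a column. An injective \<open>f\<close> amounts to its image \<open>S\<close>, a set of \<open>N\<close> columns, together with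
  an ordering of \<open>S\<close>. Reordering the columns multiplies every determinant by the same sign; signed
  directions come in pairs, so the signs cancel and all \<open>N!\<close> orderings of \<open>S\<close> contribute the same
  amount (\<open>sum_functions_eq_sum_column_sets\<close>), which absorbs the factor \<open>1 / N!\<close>. If \<open>L < N\<close> there
  is no such \<open>S\<close>.

  The argument gives an identity for two families \<open>A\<close> and \<open>B\<close> (\<open>hyperdet_Cauchy_Binet\<close>).
  Taking \<open>B\<close> to be the conjugate of \<open>A\<close> turns each pair of factors into a squared modulus.
\<close>

section \<open>Determinants and permanents of a sequence of columns\<close>

text \<open>
  The sign and the trivial character of the symmetric group, treated uniformly so that determinants
  and permanents share one development.
\<close>

definition sign_if :: "bool \<Rightarrow> (nat \<Rightarrow> nat) \<Rightarrow> 'a :: comm_ring_1" where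
  "sign_if b p = (if b then of_int (sign p) else 1)"

text \<open>
  The determinant (\<open>b\<close> true) or permanent (\<open>b\<close> false) of the matrix with columns
  \<open>f 0, \<dots>, f (N - 1)\<close> of \<open>B\<close>, in this order and possibly with repetitions. The permutation acts on
  the row index because this is how the sums over \<open>\<sigma>\<^sub>m\<close> and \<open>\<tau>\<^sub>m\<close> arise in the hyperdeterminant.
\<close>

definition column_immanant ::
    "bool \<Rightarrow> nat \<Rightarrow> 'a :: comm_ring_1 mat \<Rightarrow> (nat \<Rightarrow> nat) \<Rightarrow> 'a" where
  "column_immanant b N B f =
     (\<Sum>p | p permutes {0..<N}. sign_if b p * (\<Prod>n\<in>{0..<N}. B $$ (p n, f n)))"

lemma sign_if_square: "sign_if b p * sign_if b p = 1"
  by (simp add: sign_if_def sign_def)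

lemma sign_if_inv:
  assumes "p permutes {0..<N}"
  shows "sign_if b (Hilbert_Choice.inv p) = sign_if b p"
  by (simp add: sign_if_def signof_inv[OF _ assms])

lemma sign_if_comp:
  assumes "p permutes {0..<N}" "q permutes {0..<N}"
  shows "sign_if b (p \<circ> q) = sign_if b p * sign_if b q"
  by (simp add: sign_if_def signof_compose[OF assms])

lemma column_immanant_cong:
  assumes "\<And>n. n < N \<Longrightarrow> f n = g n"
  shows "column_immanant b N B f = column_immanant b N B g"
  using assms by (simp add: column_immanant_def)

text \<open>
  Undoing the reordering \<open>q\<close> of the columns composes each row permutation with \<open>q\<close>, and the
  character is multiplicative.
\<close>

lemma column_immanant_permute:
  assumes q: "q permutes {0..<N}"
  shows "column_immanant b N B (f \<circ> q) = sign_if b q * column_immanant b N B f"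
proof -
  have "column_immanant b N B (f \<circ> q) =
      (\<Sum>p | p permutes {0..<N}. sign_if b (p \<circ> q) * (\<Prod>n\<in>{0..<N}. B $$ ((p \<circ> q) n, (f \<circ> q) n)))"
    unfolding column_immanant_def by (rule sum_permutations_compose_right[OF q])
  also have "\<dots> = (\<Sum>p | p permutes {0..<N}. sign_if b q * (sign_if b p * (\<Prod>n\<in>{0..<N}. B $$ (p n, f n))))"
  proof (intro sum.cong refl)
    fix p assume "p \<in> {p. p permutes {0..<N}}"
    then have "sign_if b (p \<circ> q) = (sign_if b p * sign_if b q :: 'a)"
      by (intro sign_if_comp[OF _ q]) simp
    moreover have "(\<Prod>n\<in>{0..<N}. B $$ ((p \<circ> q) n, (f \<circ> q) n)) = (\<Prod>n\<in>{0..<N}. B $$ (p n, f n))"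
      using prod.permute[OF q, of "\<lambda>n. B $$ (p n, f n)"] by (simp add: o_def)
    ultimately show "sign_if b (p \<circ> q) * (\<Prod>n\<in>{0..<N}. B $$ ((p \<circ> q) n, (f \<circ> q) n)) =
        sign_if b q * (sign_if b p * (\<Prod>n\<in>{0..<N}. B $$ (p n, f n)))"
      by (simp add: mult_ac)
  qed
  also have "\<dots> = sign_if b q * column_immanant b N B f"
    by (simp add: column_immanant_def sum_distrib_left)
  finally show ?thesis .
qed

text \<open>
  Swapping two positions with equal columns leaves \<open>f\<close> unchanged but flips the sign, so the value
  equals its own negative.
\<close>

lemma column_immanant_repeated_column:
  fixes B :: "'a :: {idom, ring_char_0} mat"
  assumes "\<not> inj_on f {0..<N}"
  shows "column_immanant True N B f = 0"
proof -
  obtain i j where ij: "i < N" "j < N" "i \<noteq> j" "f i = f j"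
    using assms by (auto simp: inj_on_def)
  let ?t = "Transposition.transpose i j"
  have "f \<circ> ?t = f"
    using ij by (auto simp: Transposition.transpose_def)
  moreover have "sign_if True ?t = (-1 :: 'a)"
    using ij by (simp add: sign_if_def sign_swap_id)
  moreover have "?t permutes {0..<N}"
    using ij by (auto intro: permutes_swap_id)
  ultimately have "column_immanant True N B f = - column_immanant True N B f"
    using column_immanant_permute[of ?t N True B f] by simp
  then show ?thesis by simp
qed

lemma bij_betw_pick:
  assumes "finite S"
  shows "bij_betw (pick S) {0..<card S} S"
proof -
  have "inj_on (pick S) {0..<card S}"
    by (rule linorder_inj_onI) (use pick_mono_le[of _ S] in fastforce)+
  moreover have "pick S ` {0..<card S} \<subseteq> S"
    by (auto intro: pick_in_set_le)
  ultimately show ?thesis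
    using assms by (simp add: bij_betw_def card_image card_subset_eq)
qed

lemma column_submatrix_eq_mat:
  assumes "B \<in> carrier_mat N L" "S \<subseteq> {0..<L}" "card S = N"
  shows "column_submatrix B S = mat N N (\<lambda>(i, j). B $$ (i, pick S j))"
proof -
  have "{j. j < L \<and> j \<in> S} = S" using assms(2) by auto
  then show ?thesis
    using assms by (auto simp: column_submatrix_def submatrix_def pick_UNIV)
qed

text \<open>
  The definitions of \<open>det\<close> and \<open>permanent\<close> let the permutation act on the columns. Inverting it
  passes between the two forms, since a permutation and its inverse have the same sign.
\<close>

lemma column_immanant_row_expansion:
  "column_immanant b N B f =
     (\<Sum>p | p permutes {0..<N}. sign_if b p * (\<Prod>i\<in>{0..<N}. B $$ (i, f (p i))))"
proof -
  have "column_immanant b N B f =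
      (\<Sum>p | p permutes {0..<N}. sign_if b (Hilbert_Choice.inv p) * (\<Prod>n\<in>{0..<N}. B $$ (Hilbert_Choice.inv p n, f n)))"
    unfolding column_immanant_def by (rule sum_permutations_inverse)
  also have "\<dots> = (\<Sum>p | p permutes {0..<N}. sign_if b p * (\<Prod>i\<in>{0..<N}. B $$ (i, f (p i))))"
  proof (intro sum.cong refl)
    fix p assume "p \<in> {p. p permutes {0..<N}}"
    then have p: "p permutes {0..<N}" by simp
    have "(\<Prod>n\<in>{0..<N}. B $$ (Hilbert_Choice.inv p n, f n)) = (\<Prod>i\<in>{0..<N}. B $$ (i, f (p i)))"
      using prod.permute[OF p, of "\<lambda>n. B $$ (Hilbert_Choice.inv p n, f n)"] p
      by (simp add: o_def permutes_inverses)
    then show "sign_if b (Hilbert_Choice.inv p) * (\<Prod>n\<in>{0..<N}. B $$ (Hilbert_Choice.inv p n, f n)) =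
        sign_if b p * (\<Prod>i\<in>{0..<N}. B $$ (i, f (p i)))"
      using sign_if_inv[OF p, where 'a='a] by simp
  qed
  finally show ?thesis .
qed

lemma
  assumes "B \<in> carrier_mat N L" "S \<subseteq> {0..<L}" "card S = N"
  shows det_column_submatrix: "det (column_submatrix B S) = column_immanant True N B (pick S)"
    and permanent_column_submatrix:
      "permanent (column_submatrix B S) = column_immanant False N B (pick S)"
proof -
  have "(\<Prod>i\<in>{0..<N}. mat N N (\<lambda>(i, j). B $$ (i, pick S j)) $$ (i, p i)) =
      (\<Prod>i\<in>{0..<N}. B $$ (i, pick S (p i)))" if "p permutes {0..<N}" for p
    using permutes_in_image[OF that] by (intro prod.cong) auto
  then show "det (column_submatrix B S) = column_immanant True N B (pick S)"
    and "permanent (column_submatrix B S) = column_immanant False N B (pick S)"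
    unfolding column_submatrix_eq_mat[OF assms] column_immanant_row_expansion
    by (simp_all add: det_def permanent_def sign_if_def)
qed

section \<open>Summing over sequences of columns\<close>

text \<open>
  Once a reference bijection \<open>g\<close> is chosen, the bijections form a single free orbit under
  precomposition with permutations. Restriction to \<open>I\<close> makes each bijection a single function.
\<close>

lemma sum_bijections_eq_sum_permutations:
  assumes g: "bij_betw g I S"
  shows "(\<Sum>f | f \<in> extensional I \<and> bij_betw f I S. h f) =
    (\<Sum>q | q permutes I. h (restrict (g \<circ> q) I))"
proof (rule sum.reindex_bij_witness[where
      i = "\<lambda>q. restrict (g \<circ> q) I" and j = "\<lambda>f. restrict_id (inv_into I g \<circ> f) I"])
  fix f assume "f \<in> {f. f \<in> extensional I \<and> bij_betw f I S}"
  then have f: "f \<in> extensional I" "bij_betw f I S" by auto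
  have eq: "g (inv_into I g (f x)) = f x" if "x \<in> I" for x
    using f(2) g that by (metis bij_betwE bij_betw_inv_into_right)
  show *: "restrict (g \<circ> restrict_id (inv_into I g \<circ> f) I) I = f"
    using f(1) eq by (auto simp: restrict_id_def fun_eq_iff extensional_def)
  show "restrict_id (inv_into I g \<circ> f) I \<in> {q. q permutes I}"
    using permutes_restrict_id[OF bij_betw_trans[OF f(2) bij_betw_inv_into[OF g]]] by blast
  show "h (restrict (g \<circ> restrict_id (inv_into I g \<circ> f) I) I) = h f" by (simp only: *)
next
  fix q assume "q \<in> {q. q permutes I}"
  then have q: "q permutes I" by simp
  show "restrict_id (inv_into I g \<circ> restrict (g \<circ> q) I) I = q"
  proof
    fix x show "restrict_id (inv_into I g \<circ> restrict (g \<circ> q) I) I x = q x"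
      using q g permutes_in_image[OF q, of x] permutes_not_in[OF q, of x]
      by (auto simp: restrict_id_def bij_betw_def)
  qed
  have "bij_betw (g \<circ> q) I S"
    using bij_betw_trans[OF permutes_imp_bij[OF q] g] .
  then show "restrict (g \<circ> q) I \<in> {f. f \<in> extensional I \<and> bij_betw f I S}"
    by (simp add: bij_betw_cong[where f = "restrict (g \<circ> q) I" and g = "g \<circ> q"])
qed

text \<open>
  Injective functions are grouped by their image \<open>S\<close>. The group of \<open>S\<close> consists of the reorderings
  of the increasing enumeration of \<open>S\<close>, all with the same value of \<open>h\<close>.
  The symmetry assumption with \<open>q\<close> the identity says that \<open>h\<close> depends only on the values on
  \<open>{0..<N}\<close>, so \<open>pick S\<close> can be inserted without restricting it.
\<close>

lemma sum_functions_eq_sum_column_sets: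
  fixes h :: "(nat \<Rightarrow> nat) \<Rightarrow> 'a :: {comm_ring_1, ring_char_0}"
  assumes noninj: "\<And>f. f \<in> {0..<N} \<rightarrow>\<^sub>E {0..<L} \<Longrightarrow> \<not> inj_on f {0..<N} \<Longrightarrow> h f = 0"
    and sym: "\<And>f q. q permutes {0..<N} \<Longrightarrow> h (restrict (f \<circ> q) {0..<N}) = h f"
  shows "(\<Sum>f\<in>{0..<N} \<rightarrow>\<^sub>E {0..<L}. h f) =
    fact N * (\<Sum>S | S \<subseteq> {0..<L} \<and> card S = N. h (pick S))"
proof -
  let ?F = "{f \<in> {0..<N} \<rightarrow>\<^sub>E {0..<L}. inj_on f {0..<N}}"
  let ?C = "{S. S \<subseteq> {0..<L} \<and> card S = N}"
  have fin: "finite ?F" "finite ?C" by (simp_all add: finite_PiE)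
  have "(\<Sum>f\<in>{0..<N} \<rightarrow>\<^sub>E {0..<L}. h f) = (\<Sum>f\<in>?F. h f)"
    using noninj by (intro sum.mono_neutral_right) (auto intro: finite_PiE)
  also have "\<dots> = (\<Sum>S\<in>?C. \<Sum>f | f \<in> ?F \<and> f ` {0..<N} = S. h f)"
    by (rule sum.group[OF fin, symmetric]) (auto simp: card_image)
  also have "\<dots> = (\<Sum>S\<in>?C. fact N * h (pick S))"
  proof (intro sum.cong refl)
    fix S assume S: "S \<in> ?C"
    then have pick: "bij_betw (pick S) {0..<N} S"
      using bij_betw_pick[of S] finite_subset[of S "{0..<L}"] by auto
    have "{f. f \<in> ?F \<and> f ` {0..<N} = S} = {f. f \<in> extensional {0..<N} \<and> bij_betw f {0..<N} S}"
      using S by (auto simp: bij_betw_def PiE_def)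
    then have "(\<Sum>f | f \<in> ?F \<and> f ` {0..<N} = S. h f) =
        (\<Sum>q | q permutes {0..<N}. h (restrict (pick S \<circ> q) {0..<N}))"
      by (simp only: sum_bijections_eq_sum_permutations[OF pick])
    also have "\<dots> = (\<Sum>q | q permutes {0..<N}. h (pick S))"
      by (intro sum.cong refl) (simp add: sym)
    also have "\<dots> = fact N * h (pick S)"
      by (simp add: card_permutations)
    finally show "(\<Sum>f | f \<in> ?F \<and> f ` {0..<N} = S. h f) = fact N * h (pick S)" .
  qed
  finally show ?thesis by (simp add: sum_distrib_left)
qed

section \<open>Hyperdeterminants of sums of rank-one arrays\<close>

text \<open>
  Distributivity is used twice, in opposite directions: the product over positions of sums over
  \<open>l\<close> becomes a sum over functions \<open>f\<close>, and for fixed \<open>f\<close> the sum over tuples of permutations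
  becomes a product over directions of sums over a single permutation.
\<close>

lemma hyperdet_eq_sum_column_immanants:
  assumes K: "K \<subseteq> {1..M}"
    and T: "\<And>i j. i \<in> multi_indices M N \<Longrightarrow> j \<in> multi_indices M N \<Longrightarrow>
      T i j = (\<Sum>l\<in>{0..<L}. (\<Prod>m\<in>{1..M}. A m $$ (i m, l)) * (\<Prod>m\<in>{1..M}. B m $$ (j m, l)))"
  shows "hyperdet M N K T = 1 / fact N *
    (\<Sum>f\<in>{0..<N} \<rightarrow>\<^sub>E {0..<L}.
       \<Prod>m\<in>{1..M}. column_immanant (m \<in> K) N (A m) f * column_immanant (m \<in> K) N (B m) f)"
proof -
  let ?P = "perm_tuples M N"
  let ?w = "\<lambda>C f \<sigma> m. sign_if (m \<in> K) (\<sigma> m) * (\<Prod>n\<in>{0..<N}. C m $$ (\<sigma> m n, f n)) :: complex"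
  \<comment> \<open>Directions outside \<open>K\<close> get the trivial character, so the product can run over all directions.\<close>
  have sgn: "(\<Prod>k\<in>K. of_int (sign (\<sigma> k))) = (\<Prod>m\<in>{1..M}. sign_if (m \<in> K) (\<sigma> m) :: complex)" for \<sigma>
    using K by (intro prod.mono_neutral_cong_left) (auto simp: sign_if_def)
  have idx: "(\<lambda>m\<in>{1..M}. \<sigma> m n) \<in> multi_indices M N" if "\<sigma> \<in> ?P" "n < N" for \<sigma> n
  proof -
    have "\<sigma> m n < N" if "m \<in> {1..M}" for m
    proof -
      have "\<sigma> m permutes {0..<N}"
        using \<open>\<sigma> \<in> ?P\<close> that by (auto simp: perm_tuples_def)
      from permutes_in_image[OF this, of n] \<open>n < N\<close> show ?thesis by simp
    qed
    then show ?thesis by (auto simp: multi_indices_def)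
  qed
  have entries: "(\<Prod>n\<in>{0..<N}. T (\<lambda>m\<in>{1..M}. \<sigma> m n) (\<lambda>m\<in>{1..M}. \<tau> m n)) =
      (\<Sum>f\<in>{0..<N} \<rightarrow>\<^sub>E {0..<L}. (\<Prod>m\<in>{1..M}. \<Prod>n\<in>{0..<N}. A m $$ (\<sigma> m n, f n)) *
         (\<Prod>m\<in>{1..M}. \<Prod>n\<in>{0..<N}. B m $$ (\<tau> m n, f n)))"
    if "\<sigma> \<in> ?P" "\<tau> \<in> ?P" for \<sigma> \<tau>
  proof -
    have "(\<Prod>n\<in>{0..<N}. T (\<lambda>m\<in>{1..M}. \<sigma> m n) (\<lambda>m\<in>{1..M}. \<tau> m n)) =
      (\<Prod>n\<in>{0..<N}. \<Sum>l\<in>{0..<L}. (\<Prod>m\<in>{1..M}. A m $$ (\<sigma> m n, l)) * (\<Prod>m\<in>{1..M}. B m $$ (\<tau> m n, l)))"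
    proof (intro prod.cong refl)
      fix n assume "n \<in> {0..<N}"
      with that have "(\<lambda>m\<in>{1..M}. \<sigma> m n) \<in> multi_indices M N" "(\<lambda>m\<in>{1..M}. \<tau> m n) \<in> multi_indices M N"
        by (auto intro!: idx simp del: One_nat_def)
      from T[OF this] show "T (\<lambda>m\<in>{1..M}. \<sigma> m n) (\<lambda>m\<in>{1..M}. \<tau> m n) =
          (\<Sum>l\<in>{0..<L}. (\<Prod>m\<in>{1..M}. A m $$ (\<sigma> m n, l)) * (\<Prod>m\<in>{1..M}. B m $$ (\<tau> m n, l)))"
        by (simp cong: prod.cong_simp)
    qed
    also have "\<dots> = (\<Sum>f\<in>{0..<N} \<rightarrow>\<^sub>E {0..<L}. \<Prod>n\<in>{0..<N}.
        (\<Prod>m\<in>{1..M}. A m $$ (\<sigma> m n, f n)) * (\<Prod>m\<in>{1..M}. B m $$ (\<tau> m n, f n)))"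
      by (rule prod_sum_PiE) auto
    finally show ?thesis
      unfolding prod.distrib prod.swap[of _ "{0..<N}" "{1..M}"] .
  qed
  have factor: "(\<Sum>\<sigma>\<in>?P. \<Prod>m\<in>{1..M}. ?w C f \<sigma> m) = (\<Prod>m\<in>{1..M}. column_immanant (m \<in> K) N (C m) f)" for C f
    unfolding perm_tuples_def column_immanant_def
    by (rule prod_sum_PiE[symmetric]) (auto simp: finite_permutations)
  have "(\<Sum>\<sigma>\<in>?P. \<Sum>\<tau>\<in>?P. (\<Prod>k\<in>K. of_int (sign (\<sigma> k)) * of_int (sign (\<tau> k))) *
        (\<Prod>n\<in>{0..<N}. T (\<lambda>m\<in>{1..M}. \<sigma> m n) (\<lambda>m\<in>{1..M}. \<tau> m n))) =
      (\<Sum>\<sigma>\<in>?P. \<Sum>\<tau>\<in>?P. \<Sum>f\<in>{0..<N} \<rightarrow>\<^sub>E {0..<L}.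
         (\<Prod>m\<in>{1..M}. ?w A f \<sigma> m) * (\<Prod>m\<in>{1..M}. ?w B f \<tau> m))"
    by (intro sum.cong refl)
      (simp only: sgn entries prod.distrib sum_distrib_left mult.assoc mult.commute mult.left_commute)
  also have "\<dots> = (\<Sum>f\<in>{0..<N} \<rightarrow>\<^sub>E {0..<L}. \<Sum>\<sigma>\<in>?P. \<Sum>\<tau>\<in>?P.
         (\<Prod>m\<in>{1..M}. ?w A f \<sigma> m) * (\<Prod>m\<in>{1..M}. ?w B f \<tau> m))"
    by (subst sum.swap[of _ "{0..<N} \<rightarrow>\<^sub>E {0..<L}"], subst (2) sum.swap) (rule refl)
  also have "\<dots> = (\<Sum>f\<in>{0..<N} \<rightarrow>\<^sub>E {0..<L}.
       \<Prod>m\<in>{1..M}. column_immanant (m \<in> K) N (A m) f * column_immanant (m \<in> K) N (B m) f)"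
    unfolding sum_product[symmetric] factor by (simp only: prod.distrib)
  finally show ?thesis by (simp add: hyperdet_def)
qed

text \<open>
  Only the functions \<open>f\<close> that enumerate an \<open>N\<close>-element set of columns survive, and \<open>S\<close> represents
  its \<open>N!\<close> enumerations. Non-emptiness of \<open>K\<close> provides the signed direction that kills the functions
  with repeated columns; permanents alone would let them contribute in general.
\<close>

lemma hyperdet_Cauchy_Binet:
  assumes K: "K \<subseteq> {1..M}" "K \<noteq> {}"
    and A: "\<And>m. m \<in> {1..M} \<Longrightarrow> A m \<in> carrier_mat N L"
    and B: "\<And>m. m \<in> {1..M} \<Longrightarrow> B m \<in> carrier_mat N L"
    and T: "\<And>i j. i \<in> multi_indices M N \<Longrightarrow> j \<in> multi_indices M N \<Longrightarrow>
      T i j = (\<Sum>l\<in>{0..<L}. (\<Prod>m\<in>{1..M}. A m $$ (i m, l)) * (\<Prod>m\<in>{1..M}. B m $$ (j m, l)))"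
  shows "hyperdet M N K T =
    (\<Sum>S | S \<subseteq> {0..<L} \<and> card S = N.
       (\<Prod>k\<in>K. det (column_submatrix (A k) S) * det (column_submatrix (B k) S)) *
       (\<Prod>k\<in>{1..M} - K. permanent (column_submatrix (A k) S) * permanent (column_submatrix (B k) S)))"
proof -
  define h where "h f = (\<Prod>m\<in>{1..M}.
    column_immanant (m \<in> K) N (A m) f * column_immanant (m \<in> K) N (B m) f)" for f
  have "(\<Sum>f\<in>{0..<N} \<rightarrow>\<^sub>E {0..<L}. h f) =
      fact N * (\<Sum>S | S \<subseteq> {0..<L} \<and> card S = N. h (pick S))"
  proof (rule sum_functions_eq_sum_column_sets)
    fix f :: "nat \<Rightarrow> nat" assume "\<not> inj_on f {0..<N}"
    moreover obtain k where "k \<in> K" using K by blast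
    ultimately have "k \<in> {1..M}" "column_immanant (k \<in> K) N (A k) f = 0"
      using K by (auto simp: column_immanant_repeated_column)
    then show "h f = 0"
      unfolding h_def by (intro prod_zero) auto
  next
    fix f q assume q: "q permutes {0..<N}"
    have imm: "column_immanant b N C (restrict (f \<circ> q) {0..<N}) =
        sign_if b q * column_immanant b N C f" for b and C :: "complex mat"
      using column_immanant_cong[of N "restrict (f \<circ> q) {0..<N}" "f \<circ> q" b C]
        column_immanant_permute[OF q, of b C f] by simp
    \<comment> \<open>The two factors of a direction carry the same sign, which therefore cancels.\<close>
    have cancel: "(s * x) * (s * y) = x * y" if "s * s = 1" for s x y :: complex
      using that by (metis mult.assoc mult.left_commute mult_1)
    show "h (restrict (f \<circ> q) {0..<N}) = h f"
      unfolding h_def imm by (intro prod.cong refl cancel sign_if_square)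
  qed
  also have "(\<Sum>S | S \<subseteq> {0..<L} \<and> card S = N. h (pick S)) =
      (\<Sum>S | S \<subseteq> {0..<L} \<and> card S = N.
      (\<Prod>k\<in>K. det (column_submatrix (A k) S) * det (column_submatrix (B k) S)) *
      (\<Prod>k\<in>{1..M} - K. permanent (column_submatrix (A k) S) * permanent (column_submatrix (B k) S)))"
  proof (intro sum.cong refl)
    fix S assume "S \<in> {S. S \<subseteq> {0..<L} \<and> card S = N}"
    then have S: "S \<subseteq> {0..<L}" "card S = N" by auto
    have "h (pick S) = (\<Prod>m\<in>{1..M} - K. column_immanant (m \<in> K) N (A m) (pick S) *
          column_immanant (m \<in> K) N (B m) (pick S)) *
        (\<Prod>m\<in>K. column_immanant (m \<in> K) N (A m) (pick S) * column_immanant (m \<in> K) N (B m) (pick S))"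
      unfolding h_def using K by (intro prod.subset_diff) auto
    moreover have "k \<in> {1..M}" if "k \<in> K" for k using K that by blast
    ultimately show "h (pick S) =
        (\<Prod>k\<in>K. det (column_submatrix (A k) S) * det (column_submatrix (B k) S)) *
        (\<Prod>k\<in>{1..M} - K. permanent (column_submatrix (A k) S) * permanent (column_submatrix (B k) S))"
      using det_column_submatrix[OF A S] det_column_submatrix[OF B S]
        permanent_column_submatrix[OF A S] permanent_column_submatrix[OF B S]
      by (simp add: mult.commute cong: prod.cong_simp)
  qed
  finally have total: "(\<Sum>f\<in>{0..<N} \<rightarrow>\<^sub>E {0..<L}. h f) = fact N * \<dots>" .
  have "hyperdet M N K T = 1 / fact N * (\<Sum>f\<in>{0..<N} \<rightarrow>\<^sub>E {0..<L}. h f)"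
    unfolding h_def by (rule hyperdet_eq_sum_column_immanants[OF K(1)]) (rule T)
  then show ?thesis
    unfolding total by simp
qed

section \<open>Conjugate matrices\<close>

lemma permanent_map_mat_cnj:
  "permanent (map_mat cnj B) = cnj (permanent B)"
proof -
  have "map_mat cnj B $$ (i, p i) = cnj (B $$ (i, p i))"
    if "p permutes {0..<dim_row B}" "i < dim_row B" "dim_row B = dim_col B" for p i
    using that permutes_in_image[OF that(1), of i] by simp
  then show ?thesis by (simp add: permanent_def cong: prod.cong_simp sum.cong_simp)
qed

lemma det_map_mat_cnj:
  "det (map_mat cnj B) = cnj (det B)"
proof -
  have "map_mat cnj B $$ (i, p i) = cnj (B $$ (i, p i))"
    if "p permutes {0..<dim_row B}" "i < dim_row B" "dim_row B = dim_col B" for p i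
    using that permutes_in_image[OF that(1), of i] by simp
  then show ?thesis by (simp add: det_def cong: prod.cong_simp sum.cong_simp)
qed

lemma column_submatrix_map_mat:
  assumes "B \<in> carrier_mat N L" "S \<subseteq> {0..<L}" "card S = N"
  shows "column_submatrix (map_mat g B) S = map_mat g (column_submatrix B S)"
proof -
  have "pick S j < L" if "j < N" for j
    using pick_in_set_le[of j S] that assms by auto
  moreover have "map_mat g B \<in> carrier_mat N L"
    using assms by simp
  ultimately show ?thesis
    using assms by (auto simp: column_submatrix_eq_mat[of _ N L S])
qed

theorem proposition2p1:
  fixes M N L :: nat
    and K :: "nat set"
    and A :: "nat \<Rightarrow> complex mat"
    and T :: "complex hypercubic_array"
  assumes "M \<ge> 1" and "N \<ge> 1" and "L \<ge> 1"
    and "K \<subseteq> {1..M}" and "K \<noteq> {}"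
    and "\<And>m. m \<in> {1..M} \<Longrightarrow> A m \<in> carrier_mat N L"
    and "\<And>i j. i \<in> multi_indices M N \<Longrightarrow> j \<in> multi_indices M N \<Longrightarrow>
           T i j = (\<Sum>l\<in>{0..<L}. (\<Prod>m\<in>{1..M}. A m $$ (i m, l)) *
                                  (\<Prod>m\<in>{1..M}. map_mat cnj (A m) $$ (j m, l)))"
  shows "(L < N \<longrightarrow> hyperdet M N K T = 0) \<and>
    (N \<le> L \<longrightarrow>
      hyperdet M N K T =
        (\<Sum>S | S \<subseteq> {0..<L} \<and> card S = N.
           (\<Prod>k\<in>K. det (column_submatrix (A k) S) *
                     det (column_submatrix (map_mat cnj (A k)) S)) *
           (\<Prod>k\<in>{1..M} - K. permanent (column_submatrix (A k) S) *
                               permanent (column_submatrix (map_mat cnj (A k)) S))) \<and>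
      hyperdet M N K T =
        (\<Sum>S | S \<subseteq> {0..<L} \<and> card S = N.
           (\<Prod>k\<in>K. complex_of_real ((cmod (det (column_submatrix (A k) S)))\<^sup>2)) *
           (\<Prod>k\<in>{1..M} - K.
              complex_of_real ((cmod (permanent (column_submatrix (A k) S)))\<^sup>2))))"
proof -
  let ?C = "{S. S \<subseteq> {0..<L} \<and> card S = N}"
  have CB: "hyperdet M N K T =
      (\<Sum>S\<in>?C. (\<Prod>k\<in>K. det (column_submatrix (A k) S) *
                      det (column_submatrix (map_mat cnj (A k)) S)) *
         (\<Prod>k\<in>{1..M} - K. permanent (column_submatrix (A k) S) *
                             permanent (column_submatrix (map_mat cnj (A k)) S)))"
    by (rule hyperdet_Cauchy_Binet) (use assms in auto)
  also have "\<dots> = (\<Sum>S\<in>?C.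
      (\<Prod>k\<in>K. complex_of_real ((cmod (det (column_submatrix (A k) S)))\<^sup>2)) *
      (\<Prod>k\<in>{1..M} - K. complex_of_real ((cmod (permanent (column_submatrix (A k) S)))\<^sup>2)))"
    (is "_ = ?moduli")
  proof (intro sum.cong arg_cong2[where f = "(*)"] prod.cong refl)
    fix S k assume S: "S \<in> ?C"
    have *: "column_submatrix (map_mat cnj (A m)) S = map_mat cnj (column_submatrix (A m) S)"
      if "m \<in> {1..M}" for m
      using S assms(6)[OF that] by (intro column_submatrix_map_mat) auto
    show "det (column_submatrix (A k) S) * det (column_submatrix (map_mat cnj (A k)) S) =
        complex_of_real ((cmod (det (column_submatrix (A k) S)))\<^sup>2)" if "k \<in> K"
    proof -
      have "k \<in> {1..M}" using that assms(4) by blast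
      then show ?thesis by (simp add: * det_map_mat_cnj complex_norm_square del: of_real_power)
    qed
    show "permanent (column_submatrix (A k) S) * permanent (column_submatrix (map_mat cnj (A k)) S) =
        complex_of_real ((cmod (permanent (column_submatrix (A k) S)))\<^sup>2)" if "k \<in> {1..M} - K"
    proof -
      have "k \<in> {1..M}" using that by blast
      then show ?thesis by (simp add: * permanent_map_mat_cnj complex_norm_square del: of_real_power)
    qed
  qed
  finally have moduli: "hyperdet M N K T = ?moduli" .
  have "?C = {}" if "L < N"
    using that by (auto dest!: card_mono[OF finite_atLeastLessThan])
  then have "hyperdet M N K T = 0" if "L < N"
    unfolding CB using that by (simp only: sum.empty)
  with CB moduli show ?thesis by blast
qed

end
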